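(* Let $a<b$ be two real numbers and let $f:[a,b]\to\mathbb{R}$ be a bounded function. Then the following assertions are equivalent: (a) $f$ is Riemann integrable on $[a,b]$; (b) the set of the points of $(a,b]$ where $f$ does not admit a finite left-hand limit is Lebesgue-negligible; (c) the set of the points of $[a,b)$ where $f$ does not admit a finite right-hand limit is Lebesgue-negligible.
   Context: A subset $N\subset[a,b]$ is called Lebesgue-negligible when there exists a Borel subset $B$ of $[a,b]$ such that $N\subset B$ and $\mu(B)=0$, where $\mu$ is the Lebesgue measure on $\mathbb{R}$. One-sided limits are $f(x-):=\lim_{y\to x,\,y<x}f(y)$ for $x\in(a,b]$ (left-hand) and $f(x+):=\lim_{y\to x,\,y>x}f(y)$ for $x\in[a,b)$ (right-hand); the point $x$ itself is excluded. *)

theory Defs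
  imports "HOL-Analysis.Analysis"
begin

text \<open>
  The classical Riemann integral, as the limit of tagged Riemann sums when the mesh tends to 0.
  The mesh bound \<open>\<delta>\<close> is a constant, unlike the gauge in the library's \<^const>\<open>integrable_on\<close>
  (Henstock--Kurzweil). For a nonempty compact interval \<open>K\<close> of the real line, \<open>measure lborel K\<close> is
  the length of \<open>K\<close>. Library divisions may contain one-point intervals; these contribute 0 to the sum.
\<close>

definition has_Riemann_integral :: "(real \<Rightarrow> real) \<Rightarrow> real \<Rightarrow> real \<Rightarrow> real \<Rightarrow> bool" where
  "has_Riemann_integral f I a b \<longleftrightarrow>
    (\<forall>\<epsilon>>0. \<exists>\<delta>>0. \<forall>p. p tagged_division_of {a..b} \<and> (\<forall>(x, K)\<in>p. measure lborel K < \<delta>) \<longrightarrow>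
      \<bar>(\<Sum>(x, K)\<in>p. measure lborel K * f x) - I\<bar> < \<epsilon>)"

definition Riemann_integrable :: "(real \<Rightarrow> real) \<Rightarrow> real \<Rightarrow> real \<Rightarrow> bool" where
  "Riemann_integrable f a b \<longleftrightarrow> (\<exists>I. has_Riemann_integral f I a b)"

definition Lebesgue_negligible_in :: "real \<Rightarrow> real \<Rightarrow> real set \<Rightarrow> bool" where
  "Lebesgue_negligible_in a b N \<longleftrightarrow>
    N \<subseteq> {a..b} \<and> (\<exists>B\<in>sets borel. B \<subseteq> {a..b} \<and> N \<subseteq> B \<and> emeasure lborel B = 0)"

text \<open>
  The filters \<^term>\<open>at_left x\<close> and \<^term>\<open>at_right x\<close> exclude \<open>x\<close>. For \<open>x \<in> {a<..b}\<close>
  (resp. \<open>x \<in> {a..<b}\<close>) they only depend on the values of \<open>f\<close> on \<open>{a..b}\<close>.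
\<close>

definition no_left_limit_points :: "(real \<Rightarrow> real) \<Rightarrow> real \<Rightarrow> real \<Rightarrow> real set" where
  "no_left_limit_points f a b = {x\<in>{a<..b}. \<not> (\<exists>l::real. (f \<longlongrightarrow> l) (at_left x))}"

definition no_right_limit_points :: "(real \<Rightarrow> real) \<Rightarrow> real \<Rightarrow> real \<Rightarrow> real set" where
  "no_right_limit_points f a b = {x\<in>{a..<b}. \<not> (\<exists>l::real. (f \<longlongrightarrow> l) (at_right x))}"

end

theory Submission
  imports Defs
begin

text \<open>
  Both one-sided conditions are compared with Lebesgue's criterion: \<open>f\<close> is Riemann integrable iff its
  discontinuities form a null set. Where \<open>f\<close> is continuous both one-sided limits exist. Conversely, if
  \<open>f\<close> has a left limit at \<open>x\<close>, then \<open>f\<close> oscillates by less than \<open>e\<close> near every point of some interval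
  \<open>{x - d<..<x}\<close>; so the points with a left limit where \<open>f\<close> oscillates by at least \<open>e\<close> are isolated
  from the left, and there are only countably many of them.

  For Lebesgue's criterion itself, two choices of tags on one fine division show that the intervals
  on which \<open>f\<close> varies by at least \<open>e\<close> have small total length when \<open>f\<close> is Riemann integrable. In the
  other direction, the step functions of tagged divisions with mesh tending to 0 converge to \<open>f\<close> at
  each point of continuity, so dominated convergence applies.
\<close>

section \<open>Negligible sets and countability of one-sidedly isolated sets\<close>

text \<open>A null set of the completed measure lies in a Borel null set, and intersecting the
  latter with \<open>{a..b}\<close> gives the required Borel witness.\<close>

lemma Lebesgue_negligible_in_iff:
  "Lebesgue_negligible_in a b N \<longleftrightarrow> N \<subseteq> {a..b} \<and> negligible N"
proof
  assume "Lebesgue_negligible_in a b N"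
  then show "N \<subseteq> {a..b} \<and> negligible N"
    unfolding Lebesgue_negligible_in_def negligible_iff_null_sets null_sets_completion_iff2
    by (auto simp: null_sets_def)
next
  assume *: "N \<subseteq> {a..b} \<and> negligible N"
  then obtain B where B: "B \<in> null_sets lborel" "N \<subseteq> B"
    unfolding negligible_iff_null_sets null_sets_completion_iff2 by auto
  then have "B \<inter> {a..b} \<in> null_sets lborel"
    by (intro null_set_Int2) auto
  with * B show "Lebesgue_negligible_in a b N"
    unfolding Lebesgue_negligible_in_def by (auto simp: null_sets_def intro!: bexI[of _ "B \<inter> {a..b}"])
qed

text \<open>The gaps \<open>{l x<..<x}\<close> are pairwise disjoint: for \<open>x < y\<close> in
  \<open>S\<close>, the point \<open>x\<close> avoids the gap of \<open>y\<close>, hence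
  \<open>x \<le> l y\<close>. Choosing a rational in each gap injects \<open>S\<close> into the
  rationals.\<close>

lemma countable_left_isolated:
  fixes S :: "real set"
  assumes "\<And>x. x \<in> S \<Longrightarrow> \<exists>l<x. {l<..<x} \<inter> S = {}"
  shows "countable S"
proof -
  obtain l where l: "\<And>x. x \<in> S \<Longrightarrow> l x < x" "\<And>x. x \<in> S \<Longrightarrow> {l x<..<x} \<inter> S = {}"
    using assms by metis
  have "\<exists>q\<in>\<rat>. l x < q \<and> q < x" if "x \<in> S" for x
    using Rats_dense_in_real[OF l(1)[OF that]] .
  then obtain q where q: "\<And>x. x \<in> S \<Longrightarrow> q x \<in> \<rat>" "\<And>x. x \<in> S \<Longrightarrow> l x < q x" "\<And>x. x \<in> S \<Longrightarrow> q x < x"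
    by metis
  have less: "q x < q y" if "x \<in> S" "y \<in> S" "x < y" for x y
  proof -
    have "x \<le> l y"
      using l(2)[OF that(2)] that by (force simp: disjoint_iff)
    with q(3)[OF that(1)] q(2)[OF that(2)] show ?thesis by linarith
  qed
  have "inj_on q S"
    by (rule inj_onI) (metis less linorder_neqE less_irrefl)
  moreover have "countable (q ` S)"
    using q(1) by (intro countable_subset[OF _ countable_rat]) auto
  ultimately show ?thesis
    using countable_image_inj_on by blast
qed

lemma countable_right_isolated:
  fixes S :: "real set"
  assumes "\<And>x. x \<in> S \<Longrightarrow> \<exists>r>x. {x<..<r} \<inter> S = {}"
  shows "countable S"
proof -
  have "countable (uminus ` S)"
  proof (rule countable_left_isolated)
    fix y assume "y \<in> uminus ` S"
    then obtain x where x: "x \<in> S" "y = - x" by auto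
    with assms obtain r where "r > x" "{x<..<r} \<inter> S = {}" by blast
    with x show "\<exists>l<y. {l<..<y} \<inter> uminus ` S = {}"
      by (intro exI[of _ "- r"]) (auto simp: disjoint_iff)
  qed
  then show ?thesis
    by (simp add: countable_image_inj_eq)
qed

section \<open>Oscillation at points with a one-sided limit\<close>

text \<open>The bound is asked of an actual pair \<open>u\<close>, \<open>v\<close> rather than of a
  supremum, so that such pairs can be used as tags. The point \<open>x\<close> itself may be one of
  the two; an absolute value would give the same set, since the pair can be swapped.\<close>

definition oscillation_points :: "(real \<Rightarrow> real) \<Rightarrow> real set \<Rightarrow> real \<Rightarrow> real set" where
  "oscillation_points f S e =
    {x\<in>S. \<forall>d>0. \<exists>u\<in>S. \<exists>v\<in>S. dist u x < d \<and> dist v x < d \<and> e \<le> f u - f v}"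

definition discontinuities :: "(real \<Rightarrow> real) \<Rightarrow> real set \<Rightarrow> real set" where
  "discontinuities f S = {x\<in>S. \<not> continuous (at x within S) f}"

text \<open>Failure of continuity at \<open>x\<close> yields some \<open>e\<close> and points
  \<open>u\<close> arbitrarily near \<open>x\<close> with
  \<open>e \<le> \<bar>f u - f x\<bar>\<close>. The pair of \<open>u\<close> and \<open>x\<close>,
  ordered by the sign of the difference, shows oscillation at any level \<open>1 / Suc n\<close>
  below \<open>e\<close>.\<close>

lemma discontinuities_subset:
  "discontinuities f S \<subseteq> (\<Union>n. oscillation_points f S (1 / Suc n))"
proof
  fix x assume "x \<in> discontinuities f S"
  then obtain e where x: "x \<in> S" and e: "e > 0" "\<And>d. d > 0 \<Longrightarrow> \<exists>u\<in>S. dist u x < d \<and> e \<le> \<bar>f u - f x\<bar>"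
    unfolding discontinuities_def continuous_within_eps_delta by (force simp: dist_real_def)
  obtain n where n: "1 / Suc n < e"
    using nat_approx_posE[OF e(1)] by blast
  have "\<exists>u\<in>S. \<exists>v\<in>S. dist u x < d \<and> dist v x < d \<and> 1 / Suc n \<le> f u - f v" if "d > 0" for d
  proof -
    obtain u where u: "u \<in> S" "dist u x < d" "e \<le> \<bar>f u - f x\<bar>"
      using e(2)[OF \<open>d > 0\<close>] by blast
    show ?thesis
    proof (cases "f u \<ge> f x")
      case True
      with u x n \<open>d > 0\<close> show ?thesis
        by (intro bexI[of _ u] bexI[of _ x]) auto
    next
      case False
      with u x n \<open>d > 0\<close> show ?thesis
        by (intro bexI[of _ x] bexI[of _ u]) auto
    qed
  qed
  with x show "x \<in> (\<Union>n. oscillation_points f S (1 / Suc n))"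
    unfolding oscillation_points_def by blast
qed

text \<open>Two values within \<open>e / 2\<close> of \<open>l\<close> differ by less than
  \<open>e\<close>. It is applied to open intervals that end at a point with a one-sided limit, so
  that point itself may still oscillate.\<close>

lemma nearly_constant_imp_no_oscillation:
  assumes "open U" "\<And>y. y \<in> U \<Longrightarrow> \<bar>f y - l\<bar> < e / 2"
  shows "U \<inter> oscillation_points f S e = {}"
proof (rule ccontr)
  assume "U \<inter> oscillation_points f S e \<noteq> {}"
  then obtain x where x: "x \<in> U" "x \<in> oscillation_points f S e" by blast
  obtain d where d: "d > 0" "\<And>y. dist y x < d \<Longrightarrow> y \<in> U"
    using assms(1) x(1) unfolding open_dist by blast
  then obtain u v where uv: "dist u x < d" "dist v x < d" "e \<le> f u - f v"
    using x(2) unfolding oscillation_points_def by blast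
  then have "\<bar>f u - l\<bar> < e / 2" "\<bar>f v - l\<bar> < e / 2"
    using d(2) assms(2) by auto
  with uv(3) show False
    by linarith
qed

lemma countable_oscillation_left_limit:
  assumes "e > 0"
  shows "countable (oscillation_points f S e \<inter> {x. \<exists>l. (f \<longlongrightarrow> l) (at_left x)})"
proof (rule countable_left_isolated)
  fix x assume "x \<in> oscillation_points f S e \<inter> {x. \<exists>l. (f \<longlongrightarrow> l) (at_left x)}"
  then obtain l where "(f \<longlongrightarrow> l) (at_left x)" by blast
  then have "\<forall>\<^sub>F y in at_left x. dist (f y) l < e / 2"
    using assms by (intro tendstoD) auto
  then obtain c where c: "c < x" "\<And>y. c < y \<Longrightarrow> y < x \<Longrightarrow> dist (f y) l < e / 2"
    unfolding eventually_at_left_field by blast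
  then have "{c<..<x} \<inter> oscillation_points f S e = {}"
    by (intro nearly_constant_imp_no_oscillation[of _ _ l]) (auto simp: dist_real_def)
  with c(1) show "\<exists>c<x. {c<..<x} \<inter> (oscillation_points f S e \<inter> {x. \<exists>l. (f \<longlongrightarrow> l) (at_left x)}) = {}"
    by blast
qed

lemma countable_oscillation_right_limit:
  assumes "e > 0"
  shows "countable (oscillation_points f S e \<inter> {x. \<exists>l. (f \<longlongrightarrow> l) (at_right x)})"
proof (rule countable_right_isolated)
  fix x assume "x \<in> oscillation_points f S e \<inter> {x. \<exists>l. (f \<longlongrightarrow> l) (at_right x)}"
  then obtain l where "(f \<longlongrightarrow> l) (at_right x)" by blast
  then have "\<forall>\<^sub>F y in at_right x. dist (f y) l < e / 2"
    using assms by (intro tendstoD) auto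
  then obtain c where c: "c > x" "\<And>y. x < y \<Longrightarrow> y < c \<Longrightarrow> dist (f y) l < e / 2"
    unfolding eventually_at_right_field by blast
  then have "{x<..<c} \<inter> oscillation_points f S e = {}"
    by (intro nearly_constant_imp_no_oscillation[of _ _ l]) (auto simp: dist_real_def)
  with c(1) show "\<exists>c>x. {x<..<c} \<inter> (oscillation_points f S e \<inter> {x. \<exists>l. (f \<longlongrightarrow> l) (at_right x)}) = {}"
    by blast
qed

lemma countable_discontinuities_left_limit:
  "countable (discontinuities f S \<inter> {x. \<exists>l. (f \<longlongrightarrow> l) (at_left x)})"
proof (rule countable_subset)
  show "countable (\<Union>n::nat. oscillation_points f S (1 / Suc n) \<inter> {x. \<exists>l. (f \<longlongrightarrow> l) (at_left x)})"
    by (intro countable_UN countable_oscillation_left_limit) auto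
qed (use discontinuities_subset in blast)

lemma countable_discontinuities_right_limit:
  "countable (discontinuities f S \<inter> {x. \<exists>l. (f \<longlongrightarrow> l) (at_right x)})"
proof (rule countable_subset)
  show "countable (\<Union>n::nat. oscillation_points f S (1 / Suc n) \<inter> {x. \<exists>l. (f \<longlongrightarrow> l) (at_right x)})"
    by (intro countable_UN countable_oscillation_right_limit) auto
qed (use discontinuities_subset in blast)

section \<open>One-sided limits versus discontinuities\<close>

lemma Lebesgue_negligible_no_left_limit_iff:
  "Lebesgue_negligible_in a b (no_left_limit_points f a b) \<longleftrightarrow> negligible (discontinuities f {a..b})"
proof -
  have sub: "no_left_limit_points f a b \<subseteq> discontinuities f {a..b}"
  proof
    fix x assume x: "x \<in> no_left_limit_points f a b"
    then have "a < x" "x \<le> b"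
      by (auto simp: no_left_limit_points_def)
    moreover have "\<not> continuous (at x within {a..b}) f"
    proof
      assume "continuous (at x within {a..b}) f"
      \<comment> \<open>Since \<open>a < x\<close>, the filter at \<open>x\<close> within
        \<open>{a..x}\<close> is \<open>at_left x\<close>.\<close>
      then have "(f \<longlongrightarrow> f x) (at x within {a..x})"
        unfolding continuous_within by (rule tendsto_within_subset) (use \<open>x \<le> b\<close> in auto)
      with \<open>a < x\<close> x show False
        unfolding no_left_limit_points_def by (auto simp: at_within_Icc_at_left)
    qed
    ultimately show "x \<in> discontinuities f {a..b}"
      by (simp add: discontinuities_def)
  qed
  \<comment> \<open>The endpoint \<open>a\<close> is added separately: it can be a discontinuity,
    while \<open>no_left_limit_points\<close> ranges over \<open>{a<..b}\<close> only. The added set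
    is countable.\<close>
  have sup: "discontinuities f {a..b} \<subseteq> no_left_limit_points f a b \<union>
      (insert a (discontinuities f {a..b} \<inter> {x. \<exists>l. (f \<longlongrightarrow> l) (at_left x)}))"
    unfolding no_left_limit_points_def by (auto simp: discontinuities_def)
  have "negligible (insert a (discontinuities f {a..b} \<inter> {x. \<exists>l. (f \<longlongrightarrow> l) (at_left x)}))"
    unfolding negligible_iff_null_sets
    by (intro null_sets_completionI countable_imp_null_set_lborel countable_insert
        countable_discontinuities_left_limit)
  then have "negligible (no_left_limit_points f a b) \<longleftrightarrow> negligible (discontinuities f {a..b})"
    using negligible_subset[OF _ sub] negligible_subset[OF negligible_Un sup] by blast
  moreover have "no_left_limit_points f a b \<subseteq> {a..b}"
    by (auto simp: no_left_limit_points_def)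
  ultimately show ?thesis
    by (simp add: Lebesgue_negligible_in_iff)
qed

lemma Lebesgue_negligible_no_right_limit_iff:
  "Lebesgue_negligible_in a b (no_right_limit_points f a b) \<longleftrightarrow> negligible (discontinuities f {a..b})"
proof -
  have sub: "no_right_limit_points f a b \<subseteq> discontinuities f {a..b}"
  proof
    fix x assume x: "x \<in> no_right_limit_points f a b"
    then have "a \<le> x" "x < b"
      by (auto simp: no_right_limit_points_def)
    moreover have "\<not> continuous (at x within {a..b}) f"
    proof
      assume "continuous (at x within {a..b}) f"
      then have "(f \<longlongrightarrow> f x) (at x within {x..b})"
        unfolding continuous_within by (rule tendsto_within_subset) (use \<open>a \<le> x\<close> in auto)
      with \<open>x < b\<close> x show False
        unfolding no_right_limit_points_def by (auto simp: at_within_Icc_at_right)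
    qed
    ultimately show "x \<in> discontinuities f {a..b}"
      by (simp add: discontinuities_def)
  qed
  have sup: "discontinuities f {a..b} \<subseteq> no_right_limit_points f a b \<union>
      (insert b (discontinuities f {a..b} \<inter> {x. \<exists>l. (f \<longlongrightarrow> l) (at_right x)}))"
    unfolding no_right_limit_points_def by (auto simp: discontinuities_def)
  have "negligible (insert b (discontinuities f {a..b} \<inter> {x. \<exists>l. (f \<longlongrightarrow> l) (at_right x)}))"
    unfolding negligible_iff_null_sets
    by (intro null_sets_completionI countable_imp_null_set_lborel countable_insert
        countable_discontinuities_right_limit)
  then have "negligible (no_right_limit_points f a b) \<longleftrightarrow> negligible (discontinuities f {a..b})"
    using negligible_subset[OF _ sub] negligible_subset[OF negligible_Un sup] by blast
  moreover have "no_right_limit_points f a b \<subseteq> {a..b}"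
    by (auto simp: no_right_limit_points_def)
  ultimately show ?thesis
    by (simp add: Lebesgue_negligible_in_iff)
qed

section \<open>Fine divisions and choices of tags\<close>

lemma fine_division_of_real:
  fixes a b :: real
  assumes "\<delta> > 0"
  obtains d where "d division_of {a..b}" "\<And>K. K \<in> d \<Longrightarrow> measure lborel K < \<delta>"
proof -
  \<comment> \<open>A constant gauge gives a uniform mesh: both endpoints lie within
    \<open>\<delta> / 3\<close> of the tag, so each length is below
    \<open>2 * \<delta> / 3\<close>.\<close>
  have "gauge (\<lambda>x::real. ball x (\<delta> / 3))"
    using assms by (intro gauge_ball) simp
  then obtain p where p: "p tagged_division_of {a..b}" "(\<lambda>x. ball x (\<delta> / 3)) fine p"
    by (rule fine_division_exists_real)
  have "measure lborel K < \<delta>" if K: "K \<in> snd ` p" for K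
  proof -
    obtain x c e where x: "(x, K) \<in> p" and "x \<in> K" and ce: "K = {c..e}"
      using K tagged_division_ofD(2,4)[OF p(1)] by (fastforce simp: cbox_interval)
    then have "c \<in> ball x (\<delta> / 3)" "e \<in> ball x (\<delta> / 3)" "c \<le> e"
      using p(2) unfolding fine_def by fastforce+
    then have "e - c < \<delta>"
      using assms unfolding mem_ball dist_real_def by linarith
    then show ?thesis
      using assms ce by simp
  qed
  with division_of_tagged_division[OF p(1)] that show ?thesis by blast
qed

text \<open>Lets one division carry different tags, so that the resulting Riemann sums can be
  compared term by term.\<close>

lemma tagged_division_of_choice:
  assumes "d division_of S" "\<And>K. K \<in> d \<Longrightarrow> t K \<in> K"
  shows "(\<lambda>K. (t K, K)) ` d tagged_division_of S"
proof (rule tagged_division_ofI)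
  show "\<Union>{K. \<exists>x. (x, K) \<in> (\<lambda>K. (t K, K)) ` d} = S"
    using division_ofD(6)[OF assms(1)] by auto
qed (use assms in \<open>auto dest: division_ofD(1-5)\<close>)

text \<open>Only finitely many endpoints occur. Off this set a point is interior to every interval
  of the division that contains it.\<close>

lemma negligible_division_boundary:
  fixes S :: "real set"
  assumes "d division_of S"
  shows "negligible (\<Union>K\<in>d. K - interior K)"
proof (rule negligible_Union)
  fix T assume "T \<in> (\<lambda>K. K - interior K) ` d"
  then obtain u v where "T = cbox u v - interior (cbox u v)"
    using division_ofD(4)[OF assms] by blast
  then show "negligible T"
    by (simp only: interior_cbox negligible_frontier_interval)
qed (simp add: division_ofD(1)[OF assms])

section \<open>Riemann integrability makes discontinuities negligible\<close>

lemma Riemann_integrable_imp_negligible_oscillation: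
  assumes "Riemann_integrable f a b" "e > 0"
  shows "negligible (oscillation_points f {a..b} e)"
  unfolding negligible_outer
proof (intro allI impI)
  fix \<eta> :: real assume \<eta>: "\<eta> > 0"
  obtain I where I: "has_Riemann_integral f I a b"
    using assms(1) unfolding Riemann_integrable_def by blast
  \<comment> \<open>Two sums this close to \<open>I\<close> differ by less than
    \<open>e * \<eta>\<close>; dividing by \<open>e\<close> will bound the total length of the bad
    intervals by \<open>\<eta>\<close>.\<close>
  have "e * \<eta> / 2 > 0" using \<eta> assms(2) by simp
  then obtain \<delta> where \<delta>: "\<delta> > 0"
    "\<And>p. p tagged_division_of {a..b} \<Longrightarrow> (\<forall>(x, K)\<in>p. measure lborel K < \<delta>) \<Longrightarrow>
      \<bar>(\<Sum>(x, K)\<in>p. measure lborel K * f x) - I\<bar> < e * \<eta> / 2"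
    using I unfolding has_Riemann_integral_def by meson
  obtain d where d: "d division_of {a..b}" "\<And>K. K \<in> d \<Longrightarrow> measure lborel K < \<delta>"
    using fine_division_of_real[OF \<delta>(1)] by metis
  note dD = division_ofD[OF d(1)]
  define bad where "bad = {K\<in>d. \<exists>u\<in>K. \<exists>v\<in>K. e \<le> f u - f v}"
  \<comment> \<open>On a bad interval two tags realize a difference of at least \<open>e\<close>; on
    any other, a single point used twice gives the lower bound 0.\<close>
  have "\<exists>u v. u \<in> K \<and> v \<in> K \<and> (if K \<in> bad then e else 0) \<le> f u - f v" if "K \<in> d" for K
  proof (cases "K \<in> bad")
    case True
    then show ?thesis unfolding bad_def by auto
  next
    case False
    obtain w where "w \<in> K" using dD(3)[OF \<open>K \<in> d\<close>] by blast
    with False show ?thesis by (intro exI[of _ w]) auto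
  qed
  then obtain s t where st: "\<And>K. K \<in> d \<Longrightarrow> s K \<in> K" "\<And>K. K \<in> d \<Longrightarrow> t K \<in> K"
    "\<And>K. K \<in> d \<Longrightarrow> (if K \<in> bad then e else 0) \<le> f (s K) - f (t K)"
    by metis
  have sum: "\<bar>(\<Sum>K\<in>d. measure lborel K * f (r K)) - I\<bar> < e * \<eta> / 2" if "\<And>K. K \<in> d \<Longrightarrow> r K \<in> K" for r
    using \<delta>(2)[OF tagged_division_of_choice[OF d(1) that]] d(2)
    by (auto simp: sum.reindex inj_on_def)
  have "e * (\<Sum>K\<in>bad. measure lborel K) = (\<Sum>K\<in>d. measure lborel K * (if K \<in> bad then e else 0))"
    unfolding sum_distrib_left bad_def
    by (intro sum.mono_neutral_cong_left) (auto simp: dD(1))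
  also have "\<dots> \<le> (\<Sum>K\<in>d. measure lborel K * (f (s K) - f (t K)))"
    by (intro sum_mono mult_left_mono st(3)) auto
  also have "\<dots> < e * \<eta>"
    using sum[of s, OF st(1)] sum[of t, OF st(2)]
    unfolding right_diff_distrib sum_subtractf by linarith
  finally have bad: "(\<Sum>K\<in>bad. measure lborel K) < \<eta>"
    using assms(2) by simp
  define N where "N = (\<Union>K\<in>d. K - interior K)"
  have N: "negligible N"
    unfolding N_def by (rule negligible_division_boundary[OF d(1)])
  have finbad: "finite bad" using dD(1) by (simp add: bad_def)
  have Kmeas: "K \<in> lmeasurable" "measure lebesgue K = measure lborel K" if "K \<in> bad" for K
    using that dD(4)[of K] by (auto simp: bad_def)
  \<comment> \<open>Near an interior point of \<open>K\<close> the oscillating pair can be taken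
    inside \<open>K\<close>, which makes \<open>K\<close> bad. At an endpoint the pair may come from
    two neighbouring intervals; \<open>N\<close> absorbs these points.\<close>
  have "oscillation_points f {a..b} e \<subseteq> \<Union>bad \<union> N"
  proof
    fix x assume x: "x \<in> oscillation_points f {a..b} e"
    then have "x \<in> {a..b}" by (simp add: oscillation_points_def)
    then obtain K where K: "K \<in> d" "x \<in> K" using dD(6) by blast
    show "x \<in> \<Union>bad \<union> N"
    proof (cases "x \<in> interior K")
      case True
      then obtain r where r: "r > 0" "ball x r \<subseteq> K"
        unfolding mem_interior by blast
      obtain u v where "dist u x < r" "dist v x < r" "e \<le> f u - f v"
        using x r(1) unfolding oscillation_points_def by blast
      with r(2) have "K \<in> bad"
        using K(1) unfolding bad_def by (force simp: dist_commute)
      with K show ?thesis by blast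
    next
      case False
      with K show ?thesis by (auto simp: N_def)
    qed
  qed
  moreover have "\<Union>bad \<union> N \<in> lmeasurable"
    using finbad Kmeas(1) N by (intro fmeasurable.Un fmeasurable.finite_Union negligible_imp_measurable) auto
  moreover have "measure lebesgue (\<Union>bad \<union> N) < \<eta>"
  proof -
    have "measure lebesgue (\<Union>bad \<union> N) \<le> measure lebesgue (\<Union>bad) + measure lebesgue N"
      using finbad Kmeas(1) N
      by (intro measure_Un_le) (auto simp: negligible_imp_sets intro!: sets.finite_Union fmeasurableD)
    also have "measure lebesgue (\<Union>bad) \<le> (\<Sum>K\<in>bad. measure lebesgue K)"
      using measure_UNION_le[OF finbad, of "\<lambda>K. K" lebesgue] Kmeas(1) by auto
    also have "measure lebesgue N = 0"
      using N by (rule negligible_imp_measure0)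
    also have "(\<Sum>K\<in>bad. measure lebesgue K) = (\<Sum>K\<in>bad. measure lborel K)"
      using Kmeas(2) by (intro sum.cong) auto
    finally show ?thesis using bad by simp
  qed
  ultimately show "\<exists>T. oscillation_points f {a..b} e \<subseteq> T \<and> T \<in> lmeasurable \<and> measure lebesgue T < \<eta>"
    by blast
qed

lemma Riemann_integrable_imp_negligible_discontinuities:
  assumes "Riemann_integrable f a b"
  shows "negligible (discontinuities f {a..b})"
proof (rule negligible_subset[OF _ discontinuities_subset])
  show "negligible (\<Union>n::nat. oscillation_points f {a..b} (1 / Suc n))"
    by (intro negligible_countable_Union)
      (auto intro!: Riemann_integrable_imp_negligible_oscillation[OF assms])
qed

section \<open>Step functions and dominated convergence\<close>

text \<open>Turns a Riemann sum into an integral. Where intervals share endpoints several values add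
  up, which is harmless because the sum is integrated term by term.\<close>

lemma has_integral_step_function:
  fixes f :: "real \<Rightarrow> real"
  assumes "p tagged_division_of {a..b}"
  shows "((\<lambda>y. \<Sum>(x, K)\<in>p. if y \<in> K then f x else 0) has_integral
    (\<Sum>(x, K)\<in>p. measure lborel K * f x)) {a..b}"
  unfolding split_def
proof (rule has_integral_sum[OF tagged_division_of_finite[OF assms]])
  fix xK assume "xK \<in> p"
  then obtain c d where K: "snd xK = cbox c d" "snd xK \<subseteq> {a..b}"
    using tagged_division_ofD(3,4)[OF assms] by (metis prod.collapse)
  have "((\<lambda>y. f (fst xK)) has_integral measure lborel (snd xK) * f (fst xK)) (snd xK)"
    using has_integral_const[of "f (fst xK)" c d] unfolding K(1) by simp
  with K(2) show "((\<lambda>y. if y \<in> snd xK then f (fst xK) else 0) has_integral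
      measure lborel (snd xK) * f (fst xK)) {a..b}"
    by simp
qed

text \<open>Off the endpoints \<open>y\<close> is interior to each interval containing it, and
  distinct tagged intervals have disjoint interiors, so exactly one term survives.\<close>

lemma step_function_eq:
  fixes f :: "real \<Rightarrow> real"
  assumes p: "p tagged_division_of {a..b}" and y: "y \<in> {a..b}" "y \<notin> (\<Union>K\<in>snd ` p. K - interior K)"
  obtains x K where "(x, K) \<in> p" "x \<in> K" "y \<in> K" "(\<Sum>(x, K)\<in>p. if y \<in> K then f x else 0) = f x"
proof -
  note pD = tagged_division_ofD[OF p]
  obtain x K where xK: "(x, K) \<in> p" "y \<in> K"
    using y(1) pD(6) by blast
  have "(\<Sum>(x, K)\<in>p. if y \<in> K then f x else 0) = (\<Sum>(x, K)\<in>{(x, K)}. if y \<in> K then f x else 0)"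
  proof (rule sum.mono_neutral_right[OF pD(1)])
    show "\<forall>i\<in>p - {(x, K)}. (case i of (x, K) \<Rightarrow> if y \<in> K then f x else 0) = 0"
    proof
      fix i assume "i \<in> p - {(x, K)}"
      then obtain x' K' where i: "i = (x', K')" and *: "(x', K') \<in> p" "(x', K') \<noteq> (x, K)"
        by (cases i) auto
      have "y \<notin> K'"
      proof
        assume "y \<in> K'"
        then have "y \<in> interior K \<inter> interior K'"
          using y(2) xK *(1) by force
        with pD(5)[OF xK(1) *(1)] *(2) show False by auto
      qed
      then show "(case i of (x, K) \<Rightarrow> if y \<in> K then f x else 0) = 0"
        by (simp add: i)
    qed
  qed (use xK in auto)
  with xK pD(2)[OF xK(1)] that show ?thesis by simp
qed

lemma negligible_discontinuities_imp_Riemann_integrable: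
  assumes bdd: "bounded (f ` {a..b})" and neg: "negligible (discontinuities f {a..b})"
  shows "Riemann_integrable f a b"
  unfolding Riemann_integrable_def
proof (rule exI, rule ccontr)
  obtain M where M: "\<forall>x\<in>{a..b}. \<bar>f x\<bar> \<le> M"
    using bdd by (auto simp: bounded_iff)
  \<comment> \<open>As \<open>integral\<close> is total, its value is a legitimate candidate before
    integrability of \<open>f\<close> is known. Failure yields divisions of mesh tending to 0 whose
    sums stay at distance at least \<open>\<epsilon>\<close> from it.\<close>
  assume "\<not> has_Riemann_integral f (integral {a..b} f) a b"
  then obtain \<epsilon> where \<epsilon>: "\<epsilon> > 0" "\<And>\<delta>. \<delta> > 0 \<Longrightarrow> \<exists>p. p tagged_division_of {a..b} \<and>
      (\<forall>(x, K)\<in>p. measure lborel K < \<delta>) \<and>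
      \<not> \<bar>(\<Sum>(x, K)\<in>p. measure lborel K * f x) - integral {a..b} f\<bar> < \<epsilon>"
    unfolding has_Riemann_integral_def by meson
  have "\<exists>p. p tagged_division_of {a..b} \<and> (\<forall>(x, K)\<in>p. measure lborel K < 1 / Suc n) \<and>
      \<not> \<bar>(\<Sum>(x, K)\<in>p. measure lborel K * f x) - integral {a..b} f\<bar> < \<epsilon>" for n :: nat
    by (rule \<epsilon>(2)) simp
  then obtain p where p: "\<And>n. p n tagged_division_of {a..b}"
    "\<And>n x K. (x, K) \<in> p n \<Longrightarrow> measure lborel K < 1 / Suc n"
    "\<And>n::nat. \<not> \<bar>(\<Sum>(x, K)\<in>p n. measure lborel K * f x) - integral {a..b} f\<bar> < \<epsilon>"
    by (metis (no_types, lifting) case_prodD)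
  define g where "g n y = (\<Sum>(x, K)\<in>p n. if y \<in> K then f x else 0)" for n y
  \<comment> \<open>All exceptional points for all \<open>n\<close> at once: a countable union of
    negligible sets.\<close>
  define N where "N = discontinuities f {a..b} \<union> (\<Union>n. \<Union>K\<in>snd ` p n. K - interior K)"
  have "negligible N"
    unfolding N_def
    using negligible_division_boundary[OF division_of_tagged_division[OF p(1)]]
    by (intro negligible_Un neg negligible_countable_Union) auto
  \<comment> \<open>Removing \<open>N\<close> from \<open>{a..b}\<close> changes neither
    integrability nor integrals: \<open>sym\<close> serves the former, \<open>neg1\<close> and
    \<open>neg2\<close> the latter.\<close>
  have sym: "negligible ({a..b} - ({a..b} - N) \<union> ({a..b} - N - {a..b}))"
    by (rule negligible_subset[OF \<open>negligible N\<close>]) blast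
  have neg1: "negligible {y \<in> {a..b} - N - {a..b}. h y \<noteq> 0}"
    and neg2: "negligible {y \<in> {a..b} - ({a..b} - N). h y \<noteq> 0}" for h :: "real \<Rightarrow> real"
    by (rule negligible_subset[OF \<open>negligible N\<close>], blast)+
  have g_int: "(g n has_integral (\<Sum>(x, K)\<in>p n. measure lborel K * f x)) {a..b}" for n
    unfolding g_def by (rule has_integral_step_function[OF p(1)])
  have near: "\<exists>x\<in>{a..b}. \<bar>x - y\<bar> < 1 / Suc n \<and> g n y = f x" if y: "y \<in> {a..b} - N" for y n
  proof -
    have "y \<in> {a..b}" "y \<notin> (\<Union>K\<in>snd ` p n. K - interior K)"
      using y by (auto simp: N_def)
    then obtain x K where xK: "(x, K) \<in> p n" "x \<in> K" "y \<in> K" "g n y = f x"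
      unfolding g_def by (rule step_function_eq[OF p(1)])
    obtain c d where K: "K = {c..d}" "K \<subseteq> {a..b}"
      using tagged_division_ofD(3,4)[OF p(1) xK(1)] unfolding cbox_interval by blast
    have "\<bar>x - y\<bar> \<le> measure lborel K"
      using xK K(1) by auto
    also have "\<dots> < 1 / Suc n" by (rule p(2)[OF xK(1)])
    finally show ?thesis using xK K by blast
  qed
  have "(\<lambda>n. integral ({a..b} - N) (g n)) \<longlonglongrightarrow> integral ({a..b} - N) f"
  proof (rule dominated_convergence(2)[where h = "\<lambda>_. M"])
    show "g n integrable_on {a..b} - N" for n
      using g_int integrable_spike_set_eq[OF sym] by blast
    show "(\<lambda>_. M) integrable_on {a..b} - N"
      using integrable_spike_set_eq[OF sym] by blast
    show "norm (g n y) \<le> M" if "y \<in> {a..b} - N" for n y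
      using near[OF that, of n] M by auto
    show "(\<lambda>n. g n y) \<longlonglongrightarrow> f y" if y: "y \<in> {a..b} - N" for y
    proof -
      \<comment> \<open>The tags of the intervals containing \<open>y\<close> converge to
        \<open>y\<close>, so continuity at \<open>y\<close> carries \<open>f (x n) = g n y\<close>
        to \<open>f y\<close>.\<close>
      obtain x where x: "\<And>n. x n \<in> {a..b}" "\<And>n. \<bar>x n - y\<bar> < 1 / Suc n" "\<And>n. g n y = f (x n)"
        using near[OF y] unfolding Bex_def by metis
      have "(\<lambda>n. x n - y) \<longlonglongrightarrow> 0"
        using x(2) by (intro Lim_null_comparison[OF _ LIMSEQ_Suc[OF lim_1_over_n]])
          (auto intro!: always_eventually less_imp_le)
      then have "x \<longlonglongrightarrow> y" by (simp add: LIM_zero_iff)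
      moreover have "continuous (at y within {a..b}) f"
        using y by (auto simp: N_def discontinuities_def)
      ultimately show ?thesis
        using x(1,3) y by (auto simp: continuous_within_sequentially o_def)
    qed
  qed
  moreover have "integral ({a..b} - N) h = integral {a..b} h" for h :: "real \<Rightarrow> real"
    by (rule integral_spike_set[OF neg1 neg2])
  moreover have "integral {a..b} (g n) = (\<Sum>(x, K)\<in>p n. measure lborel K * f x)" for n
    by (rule integral_unique[OF g_int])
  ultimately have "(\<lambda>n. \<Sum>(x, K)\<in>p n. measure lborel K * f x) \<longlonglongrightarrow> integral {a..b} f"
    by simp
  then obtain n where "\<bar>(\<Sum>(x, K)\<in>p n. measure lborel K * f x) - integral {a..b} f\<bar> < \<epsilon>"
    using \<epsilon>(1) unfolding lim_sequentially dist_real_def by blast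
  with p(3) show False by blast
qed

theorem theorem6p3:
  fixes a b :: real and f :: "real \<Rightarrow> real"
  assumes "a < b"
    and "bounded (f ` {a..b})"
  shows "(Riemann_integrable f a b \<longleftrightarrow> Lebesgue_negligible_in a b (no_left_limit_points f a b)) \<and>
    (Riemann_integrable f a b \<longleftrightarrow> Lebesgue_negligible_in a b (no_right_limit_points f a b))"
  using negligible_discontinuities_imp_Riemann_integrable[OF assms(2)]
    Riemann_integrable_imp_negligible_discontinuities[of f a b]
  unfolding Lebesgue_negligible_no_left_limit_iff Lebesgue_negligible_no_right_limit_iff
  by blast

end
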